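(* Let $F$ be Thompson's group, with the word metric $d$ of the finite generating set $\{x_0,x_1\}$, and let $\psi:F\to F$ be the reverse shift map: if $w\in F$ is represented by the tree pair $(T_-,T_+)$, then $\psi(w)$ is the element represented by the tree pair $(S_-,S_+)$, where $S_-$ (respectively $S_+$) is the tree whose root caret has $T_-$ (respectively $T_+$) attached at its left leaf and whose right leaf is exposed. Then for every integer $n\ge 0$ the $n$-fold iterate $\psi^n:F\to F$ is a quasi-isometric embedding; that is, there are constants $K\ge 1$ and $C\ge 0$ (depending on $n$) such that $$\frac1K\, d(u,v)-C\;\le\; d(\psi^n(u),\psi^n(v))\;\le\; K\,d(u,v)+C\qquad\text{for all }u,v\in F.$$
   Context: Thompson's group $F$ is the group with infinite presentation $\langle x_k,\ k\ge 0 \mid x_i^{-1}x_jx_i=x_{j+1}\text{ if } i<j\rangle$; it is generated by $x_0,x_1$. For $w\in F$, $|w|$ denotes the word length with respect to $\{x_0,x_1\}$, and the word metric is $d(u,v)=|u^{-1}v|$. Tree pair description of $F$. A caret is a node together with its two (left and right) edges downward. A finite rooted binary tree is a finite rooted tree in which every vertex has either no children (an exposed leaf) or an ordered pair of children (left, right); exposed leaves are numbered from left to right starting at $0$. A tree pair is a pair $(T_-,T_+)$ of finite rooted binary trees with the same number of exposed leaves. If both $T_-$ and $T_+$ contain a caret with two exposed leaves numbered $m$ and $m+1$, deleting both carets is an elementary reduction. Elements of $F$ are the equivalence classes of tree pairs under the equivalence relation generated by elementary reductions; each class has a unique reduced representative. To multiply $w=(T_-,T_+)$ and $v=(S_-,S_+)$,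 choose equivalent (possibly unreduced) pairs $(T'_-,T'_+)$ and $(S'_-,S'_+)$ with $T'_-=S'_+$; then $wv=(S'_-,T'_+)$. The inverse of $(T_-,T_+)$ is $(T_+,T_-)$. The generator $x_n$ corresponds to the pair $(T_-,T_+)$ in which $T_-$ consists of a root caret followed by $n+1$ successive right children, and $T_+$ consists of a root caret followed by $n$ successive right children together with one more caret attached to the left leaf of the last of these carets (of the root caret if $n=0$). The class of $(S_-,S_+)$ in the definition of $\psi$ depends only on the class of $(T_-,T_+)$. *)

theory Defs
  imports Complex_Main "HOL-Algebra.Group"
begin

section \<open>Word metrics and quasi-isometric embeddings\<close>

definition word_length :: "('a, 'b) monoid_scheme \<Rightarrow> 'a set \<Rightarrow> 'a \<Rightarrow> nat" where
  "word_length G S g =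
     (LEAST n. \<exists>ws. length ws = n \<and> set ws \<subseteq> S \<union> m_inv G ` S \<and>
        foldr (mult G) ws \<one>\<^bsub>G\<^esub> = g)"

definition word_metric :: "('a, 'b) monoid_scheme \<Rightarrow> 'a set \<Rightarrow> 'a \<Rightarrow> 'a \<Rightarrow> real" where
  "word_metric G S u v = real (word_length G S (inv\<^bsub>G\<^esub> u \<otimes>\<^bsub>G\<^esub> v))"

definition quasi_isometric_embedding ::
  "'a set \<Rightarrow> ('a \<Rightarrow> 'a \<Rightarrow> real) \<Rightarrow> 'b set \<Rightarrow> ('b \<Rightarrow> 'b \<Rightarrow> real) \<Rightarrow> ('a \<Rightarrow> 'b) \<Rightarrow> bool" where
  "quasi_isometric_embedding X dX Y dY f \<longleftrightarrow>
     f \<in> X \<rightarrow> Y \<and>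
     (\<exists>K C :: real. K \<ge> 1 \<and> C \<ge> 0 \<and>
        (\<forall>u\<in>X. \<forall>v\<in>X. 1 / K * dX u v - C \<le> dY (f u) (f v) \<and>
                       dY (f u) (f v) \<le> K * dX u v + C))"

section \<open>Tree pairs\<close>

datatype tree = Leaf | Caret tree tree

fun leaves :: "tree \<Rightarrow> nat" where
  "leaves Leaf = 1"
| "leaves (Caret l r) = leaves l + leaves r"

text \<open>Attach a caret at exposed leaf number \<open>m\<close>, counted from the left starting at 0.  The exposed
  leaves of the new caret are then numbered \<open>m\<close> and \<open>m + 1\<close>.  For \<open>m \<ge> leaves T\<close> the value is
  irrelevant.\<close>

fun add_caret :: "nat \<Rightarrow> tree \<Rightarrow> tree" where
  "add_caret m Leaf = Caret Leaf Leaf"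
| "add_caret m (Caret l r) =
     (if m < leaves l then Caret (add_caret m l) r else Caret l (add_caret (m - leaves l) r))"

text \<open>The pair \<open>(S, T)\<close> stands for \<open>(T\<^sub>-, T\<^sub>+)\<close>, in this order.\<close>

definition tree_pairs :: "(tree \<times> tree) set" where
  "tree_pairs = {(S, T). leaves S = leaves T}"

text \<open>A tree contains a caret with exposed leaves \<open>m\<close> and \<open>m + 1\<close> iff it is of the form
  \<open>add_caret m S\<close> with \<open>m < leaves S\<close>, and \<open>S\<close> is then the result of deleting that caret.\<close>

definition elementary_reduction :: "((tree \<times> tree) \<times> (tree \<times> tree)) set" where
  "elementary_reduction =
     {((add_caret m S, add_caret m T), (S, T)) | m S T. (S, T) \<in> tree_pairs \<and> m < leaves S}"

definition pair_equiv :: "((tree \<times> tree) \<times> (tree \<times> tree)) set" where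
  "pair_equiv = (elementary_reduction \<union> elementary_reduction\<inverse>)\<^sup>* \<inter> tree_pairs \<times> tree_pairs"

definition pair_class :: "tree \<Rightarrow> tree \<Rightarrow> (tree \<times> tree) set" where
  "pair_class S T = pair_equiv `` {(S, T)}"

section \<open>Thompson's group F\<close>

text \<open>Elements are equivalence classes, i.e. sets of tree pairs.  The relation composition \<open>v O w\<close>
  consists of all pairs \<open>(S', T')\<close> such that \<open>(S', U) \<in> v\<close> and \<open>(U, T') \<in> w\<close> for some tree \<open>U\<close>; the
  product \<open>wv\<close> is the class of any of them (\<open>mult_pair_class\<close>, \<open>common_middle\<close> below).\<close>

definition thompson_F :: "(tree \<times> tree) set monoid" where
  "thompson_F =
     \<lparr> carrier = tree_pairs // pair_equiv,
       mult = (\<lambda>w v. pair_equiv `` (v O w)),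
       one = pair_class Leaf Leaf \<rparr>"

fun right_comb :: "nat \<Rightarrow> tree" where
  "right_comb 0 = Leaf"
| "right_comb (Suc n) = Caret Leaf (right_comb n)"

text \<open>A root caret with \<open>n\<close> successive right children, and one more caret on the left leaf of the
  last of these.\<close>

fun gen_tree :: "nat \<Rightarrow> tree" where
  "gen_tree 0 = Caret (Caret Leaf Leaf) Leaf"
| "gen_tree (Suc n) = Caret Leaf (gen_tree n)"

text \<open>\<open>right_comb k\<close> has \<open>k\<close> carets, so a root caret with \<open>n + 1\<close> successive right children is
  \<open>right_comb (n + 2)\<close>.\<close>

definition gen_x :: "nat \<Rightarrow> (tree \<times> tree) set" where
  "gen_x n = pair_class (right_comb (n + 2)) (gen_tree n)"

abbreviation dist_F :: "(tree \<times> tree) set \<Rightarrow> (tree \<times> tree) set \<Rightarrow> real" where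
  "dist_F \<equiv> word_metric thompson_F {gen_x 0, gen_x 1}"

text \<open>The reverse shift map: the image pairs of all representatives of \<open>w\<close> are equivalent, and
  \<open>reverse_shift w\<close> is their class (\<open>reverse_shift_pair_class\<close> below).\<close>

definition reverse_shift :: "(tree \<times> tree) set \<Rightarrow> (tree \<times> tree) set" where
  "reverse_shift w = pair_equiv `` ((\<lambda>(S, T). (Caret S Leaf, Caret T Leaf)) ` w)"

section \<open>Well-definedness\<close>

lemma leaves_pos [simp]: "leaves T > 0"
  by (induction T) auto

lemma leaves_add_caret: "leaves (add_caret m T) = Suc (leaves T)"
  by (induction T arbitrary: m) auto

lemma elementary_reduction_tree_pairs:
  "(p, q) \<in> elementary_reduction \<Longrightarrow> p \<in> tree_pairs \<and> q \<in> tree_pairs"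
  by (auto simp: elementary_reduction_def tree_pairs_def leaves_add_caret)

lemma equiv_pair_equiv: "equiv tree_pairs pair_equiv"
proof (rule equivI)
  show "pair_equiv \<subseteq> tree_pairs \<times> tree_pairs"
    by (auto simp: pair_equiv_def)
  show "refl_on tree_pairs pair_equiv"
    by (auto simp: refl_on_def pair_equiv_def)
  have "sym ((elementary_reduction \<union> elementary_reduction\<inverse>)\<^sup>*)"
    by (intro sym_rtrancl sym_Un_converse)
  then show "sym pair_equiv"
    unfolding pair_equiv_def sym_def by blast
  show "trans pair_equiv"
    unfolding pair_equiv_def by (intro trans_Int trans_rtrancl) (auto simp: trans_def)
qed

text \<open>\<open>graft T ts\<close> attaches the trees \<open>ts\<close> at the exposed leaves of \<open>T\<close>.\<close>

fun graft :: "tree \<Rightarrow> tree list \<Rightarrow> tree" where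
  "graft Leaf ts = hd ts"
| "graft (Caret l r) ts = Caret (graft l (take (leaves l) ts)) (graft r (drop (leaves l) ts))"

lemma graft_Caret:
  "length ts = leaves l \<Longrightarrow> graft (Caret l r) (ts @ us) = Caret (graft l ts) (graft r us)"
  by simp

declare graft.simps(2) [simp del]

lemma split_Caret:
  assumes "length ts = leaves (Caret l r)"
  obtains us vs where "ts = us @ vs" "length us = leaves l" "length vs = leaves r"
proof
  show "ts = take (leaves l) ts @ drop (leaves l) ts" by simp
qed (use assms in auto)

lemma leaves_graft: "length ts = leaves T \<Longrightarrow> leaves (graft T ts) = sum_list (map leaves ts)"
proof (induction T arbitrary: ts)
  case Leaf
  then show ?case by (cases ts) auto
next
  case (Caret l r)
  from Caret.prems obtain us vs
    where "ts = us @ vs" "length us = leaves l" "length vs = leaves r"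
    by (rule split_Caret)
  then show ?case using Caret.IH by (simp add: graft_Caret)
qed

lemma graft_Leafs: "graft T (replicate (leaves T) Leaf) = T"
  by (induction T) (auto simp: replicate_add graft_Caret)

lemma graft_inj:
  "length ts = leaves T \<Longrightarrow> length us = leaves T \<Longrightarrow> graft T ts = graft T us \<Longrightarrow> ts = us"
proof (induction T arbitrary: ts us)
  case Leaf
  then show ?case by (cases ts; cases us) auto
next
  case (Caret l r)
  from Caret.prems(1) obtain ts1 ts2
    where 1: "ts = ts1 @ ts2" "length ts1 = leaves l" "length ts2 = leaves r"
    by (rule split_Caret)
  from Caret.prems(2) obtain us1 us2
    where 2: "us = us1 @ us2" "length us1 = leaves l" "length us2 = leaves r"
    by (rule split_Caret)
  show ?case using Caret.prems(3) Caret.IH 1 2 by (simp add: graft_Caret)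
qed

lemma graft_common: "\<exists>ts us. length ts = leaves S \<and> length us = leaves T \<and> graft S ts = graft T us"
proof (induction S arbitrary: T)
  case Leaf
  show ?case
    by (intro exI[of _ "[T]"] exI[of _ "replicate (leaves T) Leaf"]) (simp add: graft_Leafs)
next
  case (Caret l r)
  show ?case
  proof (cases T)
    case Leaf
    then show ?thesis
      by (intro exI[of _ "replicate (leaves (Caret l r)) Leaf"] exI[of _ "[Caret l r]"])
        (simp only: graft_Leafs, simp)
  next
    case T: (Caret l' r')
    obtain ts us where 1: "length ts = leaves l" "length us = leaves l'" "graft l ts = graft l' us"
      using Caret.IH(1) by blast
    obtain ts' us' where 2: "length ts' = leaves r" "length us' = leaves r'"
      "graft r ts' = graft r' us'"
      using Caret.IH(2) by blast
    show ?thesis using 1 2 T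
      by (intro exI[of _ "ts @ ts'"] exI[of _ "us @ us'"]) (simp add: graft_Caret)
  qed
qed

lemma graft_graft:
  "length ts = leaves T \<Longrightarrow> map length uss = map leaves ts \<Longrightarrow>
     graft (graft T ts) (concat uss) = graft T (map2 graft ts uss)"
proof (induction T arbitrary: ts uss)
  case Leaf
  then obtain t where "ts = [t]" by (cases ts) auto
  then show ?case using Leaf by (cases uss) auto
next
  case (Caret l r)
  from Caret.prems(1) obtain ts1 ts2
    where 1: "ts = ts1 @ ts2" "length ts1 = leaves l" "length ts2 = leaves r"
    by (rule split_Caret)
  have "length uss = length ts" using Caret.prems(2) map_eq_imp_length_eq by blast
  define us1 us2 where "us1 = take (leaves l) uss" and "us2 = drop (leaves l) uss"
  have 2: "uss = us1 @ us2" "length us1 = leaves l"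
    using \<open>length uss = length ts\<close> 1 by (auto simp: us1_def us2_def)
  have 3: "map length us1 = map leaves ts1" "map length us2 = map leaves ts2"
    using Caret.prems(2) 1 2 by auto
  have 4: "length (concat us1) = leaves (graft l ts1)"
    using 1 3 by (simp add: length_concat leaves_graft)
  show ?case
    using 1 2 3 4 Caret.IH by (simp add: graft_Caret)
qed

lemma split_concat:
  "length us = sum_list (map leaves ts) \<Longrightarrow> \<exists>uss. concat uss = us \<and> map length uss = map leaves ts"
proof (induction ts arbitrary: us)
  case (Cons t ts)
  then obtain uss where "concat uss = drop (leaves t) us" "map length uss = map leaves ts"
    by (metis add_diff_cancel_left' length_drop list.map(2) sum_list.Cons)
  then show ?case using Cons.prems
    by (intro exI[of _ "take (leaves t) us # uss"]) auto
qed auto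

definition expands :: "tree \<times> tree \<Rightarrow> tree \<times> tree \<Rightarrow> bool" where
  "expands p q \<longleftrightarrow>
     (\<exists>ts. length ts = leaves (fst p) \<and> q = (graft (fst p) ts, graft (snd p) ts))"

lemma expands_tree_pairs: "p \<in> tree_pairs \<Longrightarrow> expands p q \<Longrightarrow> q \<in> tree_pairs"
  by (auto simp: expands_def tree_pairs_def leaves_graft)

lemma expands_refl: "p \<in> tree_pairs \<Longrightarrow> expands p p"
  unfolding expands_def tree_pairs_def
  by (intro exI[of _ "replicate (leaves (fst p)) Leaf"]) (auto, metis graft_Leafs, metis graft_Leafs)

lemma expands_trans:
  assumes p: "p \<in> tree_pairs" and "expands p q" "expands q r"
  shows "expands p r"
proof -
  obtain ts where ts: "length ts = leaves (fst p)" "q = (graft (fst p) ts, graft (snd p) ts)"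
    using assms unfolding expands_def by blast
  obtain us where us: "length us = leaves (fst q)" "r = (graft (fst q) us, graft (snd q) us)"
    using assms unfolding expands_def by blast
  have ts': "length ts = leaves (snd p)" using p ts by (auto simp: tree_pairs_def)
  have "length us = sum_list (map leaves ts)" using ts us by (simp add: leaves_graft)
  then obtain uss where uss: "concat uss = us" "map length uss = map leaves ts"
    using split_concat by blast
  have "length uss = length ts" using uss(2) map_eq_imp_length_eq by blast
  then show ?thesis
    using ts ts' us uss graft_graft unfolding expands_def
    by (intro exI[of _ "map2 graft ts uss"]) auto
qed

lemma expands_join:
  assumes p: "p \<in> tree_pairs" and "expands p q" "expands p r"
  shows "\<exists>s. expands q s \<and> expands r s"
proof -
  obtain ts where ts: "length ts = leaves (fst p)" "q = (graft (fst p) ts, graft (snd p) ts)"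
    using assms unfolding expands_def by blast
  obtain us where us: "length us = leaves (fst p)" "r = (graft (fst p) us, graft (snd p) us)"
    using assms unfolding expands_def by blast
  have snd: "leaves (snd p) = leaves (fst p)" using p by (auto simp: tree_pairs_def)
  have "\<exists>tss uss. map length tss = map leaves ts \<and> map length uss = map leaves us \<and>
      map2 graft ts tss = map2 graft us uss" if "length ts = length us" for ts us
    using that
  proof (induction ts us rule: list_induct2)
    case (Cons t ts u us)
    then obtain tss uss where "map length tss = map leaves ts" "map length uss = map leaves us"
      "map2 graft ts tss = map2 graft us uss" by blast
    moreover obtain t' u' where "length t' = leaves t" "length u' = leaves u"
      "graft t t' = graft u u'" using graft_common by blast
    ultimately show ?case
      by (intro exI[of _ "t' # tss"] exI[of _ "u' # uss"]) simp
  qed auto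
  then obtain tss uss where *: "map length tss = map leaves ts" "map length uss = map leaves us"
      "map2 graft ts tss = map2 graft us uss"
    using ts us by metis
  have "length (concat tss) = leaves (fst q)" "length (concat uss) = leaves (fst r)"
    using * ts us by (auto simp: length_concat leaves_graft)
  moreover have "(graft (fst q) (concat tss), graft (snd q) (concat tss)) =
      (graft (fst r) (concat uss), graft (snd r) (concat uss))"
    using * ts us snd by (simp add: graft_graft)
  ultimately show ?thesis unfolding expands_def by metis
qed

lemma graft_add_caret:
  "length xs + 1 + length ys = leaves T \<Longrightarrow>
     graft T (xs @ Caret l r # ys) = graft (add_caret (length xs) T) (xs @ l # r # ys)"
proof (induction T arbitrary: xs ys)
  case Leaf
  then show ?case by (simp add: graft.simps)
next
  case (Caret a b)
  show ?case
  proof (cases "length xs < leaves a")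
    case True
    define k where "k = leaves a - length xs - 1"
    define y1 y2 where "y1 = take k ys" and "y2 = drop k ys"
    have ys: "ys = y1 @ y2" and len: "length xs + 1 + length y1 = leaves a"
      using True Caret.prems by (auto simp: y1_def y2_def k_def)
    have 1: "graft (Caret a b) (xs @ Caret l r # ys) =
        Caret (graft a (xs @ Caret l r # y1)) (graft b y2)"
      using graft_Caret[of "xs @ Caret l r # y1" a b y2] len ys by simp
    have 2: "graft (Caret (add_caret (length xs) a) b) (xs @ l # r # ys) =
        Caret (graft (add_caret (length xs) a) (xs @ l # r # y1)) (graft b y2)"
      using graft_Caret[of "xs @ l # r # y1" "add_caret (length xs) a" b y2] len ys
      by (simp add: leaves_add_caret)
    show ?thesis using 1 2 Caret.IH(1)[OF len] True by simp
  next
    case False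
    define x1 x2 where "x1 = take (leaves a) xs" and "x2 = drop (leaves a) xs"
    have xs: "xs = x1 @ x2" and len: "length x1 = leaves a" "length x2 + 1 + length ys = leaves b"
      using False Caret.prems by (auto simp: x1_def x2_def)
    show ?thesis using Caret.IH(2)[OF len(2)] len xs by (simp add: graft_Caret)
  qed
qed

lemma elementary_reduction_expands:
  assumes "(p, q) \<in> elementary_reduction"
  shows "expands q p"
proof -
  obtain m S T where *: "p = (add_caret m S, add_caret m T)" "q = (S, T)"
    "leaves S = leaves T" "m < leaves S"
    using assms by (auto simp: elementary_reduction_def tree_pairs_def)
  define ts where "ts = replicate m Leaf @ Caret Leaf Leaf # replicate (leaves S - m - 1) Leaf"
  have "graft U ts = add_caret m U" if "leaves U = leaves S" for U
  proof -
    have "replicate m Leaf @ Leaf # Leaf # replicate (leaves S - m - 1) Leaf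
        = replicate (leaves (add_caret m U)) Leaf"
      using that * by (intro replicate_eqI) (auto simp: leaves_add_caret)
    then show ?thesis
      using graft_add_caret[of "replicate m Leaf" "replicate (leaves S - m - 1) Leaf" U Leaf Leaf]
        that * by (simp add: ts_def graft_Leafs)
  qed
  moreover have "length ts = leaves S" using * by (simp add: ts_def)
  ultimately show ?thesis using * unfolding expands_def by auto
qed

lemma graft_pair_equiv:
  "leaves S = leaves T \<Longrightarrow> length ts = leaves S \<Longrightarrow>
     ((S, T), (graft S ts, graft T ts)) \<in> pair_equiv"
proof (induction "sum_list (map size ts)" arbitrary: S T ts rule: less_induct)
  case less
  show ?case
  proof (cases "\<forall>t\<in>set ts. t = Leaf")
    case True
    then have "ts = replicate (leaves S) Leaf" using less.prems by (intro replicate_eqI) auto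
    then have "graft S ts = S" "graft T ts = T" using less.prems by (metis graft_Leafs)+
    then show ?thesis using less.prems by (auto simp: pair_equiv_def tree_pairs_def)
  next
    case False
    then obtain xs l r ys where ts: "ts = xs @ Caret l r # ys"
      by (metis split_list tree.exhaust)
    let ?S = "add_caret (length xs) S" and ?T = "add_caret (length xs) T"
    let ?us = "xs @ l # r # ys"
    have "((?S, ?T), (S, T)) \<in> elementary_reduction"
      using less.prems ts by (auto simp: elementary_reduction_def tree_pairs_def)
    then have 1: "((S, T), (?S, ?T)) \<in> pair_equiv"
      using elementary_reduction_tree_pairs unfolding pair_equiv_def by blast
    have 2: "((?S, ?T), (graft ?S ?us, graft ?T ?us)) \<in> pair_equiv"
      using less.prems ts by (intro less.hyps) (auto simp: leaves_add_caret)
    have "graft ?S ?us = graft S ts" "graft ?T ?us = graft T ts"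
      using less.prems ts by (auto simp: graft_add_caret)
    then show ?thesis using 1 2 equiv_pair_equiv by (metis equivE transD)
  qed
qed

lemma pair_equiv_iff:
  "(p, q) \<in> pair_equiv \<longleftrightarrow>
     p \<in> tree_pairs \<and> q \<in> tree_pairs \<and> (\<exists>s. expands p s \<and> expands q s)"
proof
  assume *: "(p, q) \<in> pair_equiv"
  then have p: "p \<in> tree_pairs" and q: "q \<in> tree_pairs" by (auto simp: pair_equiv_def)
  have "(p, q) \<in> (elementary_reduction \<union> elementary_reduction\<inverse>)\<^sup>*"
    using * by (auto simp: pair_equiv_def)
  then have "q \<in> tree_pairs \<and> (\<exists>s. expands p s \<and> expands q s)"
  proof (induction rule: rtrancl_induct)
    case base
    then show ?case using p expands_refl by blast
  next
    case (step y z)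
    then obtain s where s: "expands p s" "expands y s" and y: "y \<in> tree_pairs" by blast
    have z: "z \<in> tree_pairs" using step(2) elementary_reduction_tree_pairs by blast
    have "expands z y \<or> expands y z" using step(2) elementary_reduction_expands by blast
    then show ?case
    proof
      assume "expands z y"
      then show ?thesis using s z expands_trans by blast
    next
      assume "expands y z"
      then show ?thesis using s z y p expands_join[OF y s(2)] expands_trans by blast
    qed
  qed
  then show "p \<in> tree_pairs \<and> q \<in> tree_pairs \<and> (\<exists>s. expands p s \<and> expands q s)"
    using p by blast
next
  assume *: "p \<in> tree_pairs \<and> q \<in> tree_pairs \<and> (\<exists>s. expands p s \<and> expands q s)"
  then obtain s where s: "expands p s" "expands q s" by blast
  have "(r, s) \<in> pair_equiv" if "r \<in> tree_pairs" "expands r s" for r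
    using that graft_pair_equiv by (cases r) (auto simp: expands_def tree_pairs_def)
  then show "(p, q) \<in> pair_equiv"
    using * s equiv_pair_equiv by (meson equivE symD transD)
qed

lemma pair_class_eq_iff:
  assumes "leaves S = leaves T" "leaves S' = leaves T'"
  shows "pair_class S T = pair_class S' T' \<longleftrightarrow> ((S, T), (S', T')) \<in> pair_equiv"
  using eq_equiv_class_iff[OF equiv_pair_equiv] assms by (simp add: pair_class_def tree_pairs_def)

lemma pair_class_graft:
  "leaves S = leaves T \<Longrightarrow> length ts = leaves S \<Longrightarrow>
     pair_class (graft S ts) (graft T ts) = pair_class S T"
  using graft_pair_equiv by (metis equiv_class_eq equiv_pair_equiv pair_class_def)

lemma carrier_thompson_F:
  "w \<in> carrier thompson_F \<longleftrightarrow> (\<exists>S T. leaves S = leaves T \<and> w = pair_class S T)"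
  by (auto simp: thompson_F_def quotient_def tree_pairs_def pair_class_def)

lemma pair_equiv_comp:
  assumes 1: "((A, B), (A', B')) \<in> pair_equiv" and 2: "((B, C), (B', C')) \<in> pair_equiv"
  shows "((A, C), (A', C')) \<in> pair_equiv"
proof -
  have l: "leaves A = leaves B" "leaves B = leaves C" "leaves A' = leaves B'" "leaves B' = leaves C'"
    using 1 2 by (auto simp: pair_equiv_def tree_pairs_def)
  obtain ts ts' where t: "length ts = leaves B" "length ts' = leaves B'"
    "graft A ts = graft A' ts'" "graft B ts = graft B' ts'"
    using 1 l unfolding pair_equiv_iff expands_def by auto
  obtain us us' where u: "length us = leaves B" "length us' = leaves B'"
    "graft B us = graft B' us'" "graft C us = graft C' us'"
    using 2 l unfolding pair_equiv_iff expands_def by auto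
  have tp: "(B, B) \<in> tree_pairs" "(B', B') \<in> tree_pairs" by (auto simp: tree_pairs_def)
  have e: "expands (B, B) (graft B ts, graft B ts)" "expands (B, B) (graft B us, graft B us)"
    using t u unfolding expands_def by auto
  obtain vs ws where v: "length vs = leaves (graft B ts)" "length ws = leaves (graft B us)"
    "graft (graft B ts) vs = graft (graft B us) ws"
    using expands_join[OF tp(1) e] unfolding expands_def by auto
  have flat: "\<exists>zs. length zs = leaves V \<and> (\<forall>U. leaves U = leaves V \<longrightarrow> graft (graft U xs) ys = graft U zs)"
    if "length xs = leaves V" "length ys = leaves (graft V xs)" for V xs ys
  proof -
    have "length ys = sum_list (map leaves xs)" using that by (simp add: leaves_graft)
    then obtain yss where y: "concat yss = ys" "map length yss = map leaves xs"
      using split_concat by blast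
    have "length yss = length xs" using y(2) map_eq_imp_length_eq by blast
    then show ?thesis using that y graft_graft by (intro exI[of _ "map2 graft xs yss"]) auto
  qed
  obtain a where a: "length a = leaves B"
    "\<And>U. leaves U = leaves B \<Longrightarrow> graft (graft U ts) vs = graft U a"
    using flat[OF t(1) v(1)] by blast
  obtain b where b: "length b = leaves B"
    "\<And>U. leaves U = leaves B \<Longrightarrow> graft (graft U us) ws = graft U b"
    using flat[OF u(1) v(2)] by blast
  obtain a' where a': "length a' = leaves B'"
    "\<And>U. leaves U = leaves B' \<Longrightarrow> graft (graft U ts') vs = graft U a'"
    using flat[OF t(2)] v(1) t by metis
  obtain b' where b': "length b' = leaves B'"
    "\<And>U. leaves U = leaves B' \<Longrightarrow> graft (graft U us') ws = graft U b'"
    using flat[OF u(2)] v(2) u by metis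
  have "a = b" using a b v graft_inj by metis
  have "graft B' a' = graft B' b'" using a'(2)[of B'] b'(2)[of B'] v(3) t(4) u(3) by simp
  then have "a' = b'" using a' b' graft_inj by metis
  have "graft A a = graft A' a'" using a(2)[of A] a'(2)[of A'] t(3) l by simp
  moreover have "graft C a = graft C' a'"
    using b(2)[of C] b'(2)[of C'] u(4) l \<open>a = b\<close> \<open>a' = b'\<close> by simp
  ultimately show ?thesis
    using l a(1) a'(1) unfolding pair_equiv_iff expands_def tree_pairs_def
    by (intro conjI exI[of _ "(graft A a, graft C a)"] exI[of _ a] exI[of _ a']) auto
qed

lemma mult_pair_class:
  assumes "leaves A = leaves B" "leaves B = leaves C"
  shows "pair_class B C \<otimes>\<^bsub>thompson_F\<^esub> pair_class A B = pair_class A C"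
proof -
  have "pair_equiv `` (pair_class A B O pair_class B C) = pair_class A C"
  proof (intro equalityI subsetI)
    fix p assume "p \<in> pair_equiv `` (pair_class A B O pair_class B C)"
    then obtain A' B' C' where *: "((A, B), (A', B')) \<in> pair_equiv"
      "((B, C), (B', C')) \<in> pair_equiv" "((A', C'), p) \<in> pair_equiv"
      by (auto simp: pair_class_def)
    then show "p \<in> pair_class A C"
      using pair_equiv_comp[OF *(1,2)] equiv_pair_equiv unfolding pair_class_def
      by (meson Image_singleton_iff equivE transD)
  next
    fix p assume "p \<in> pair_class A C"
    moreover have "(A, B) \<in> pair_class A B" "(B, C) \<in> pair_class B C"
      using assms by (auto simp: pair_class_def pair_equiv_def tree_pairs_def)
    ultimately show "p \<in> pair_equiv `` (pair_class A B O pair_class B C)"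
      unfolding pair_class_def by blast
  qed
  then show ?thesis by (simp add: thompson_F_def)
qed

lemma common_middle:
  assumes "leaves A = leaves B" "leaves B' = leaves C"
  obtains ts us where "length ts = leaves B" "length us = leaves C" "graft B ts = graft B' us"
    "pair_class A B = pair_class (graft A ts) (graft B ts)"
    "pair_class B' C = pair_class (graft B ts) (graft C us)"
  using graft_common[of B B'] pair_class_graft assms by metis

lemma common_middle_carrier:
  assumes "v \<in> carrier thompson_F" "w \<in> carrier thompson_F"
  obtains A B C where "leaves A = leaves B" "leaves B = leaves C"
    "v = pair_class A B" "w = pair_class B C"
proof -
  obtain A B B' C where *: "leaves A = leaves B" "leaves B' = leaves C"
    "v = pair_class A B" "w = pair_class B' C"
    using assms carrier_thompson_F by metis
  obtain ts us where "length ts = leaves B" "length us = leaves C" "graft B ts = graft B' us"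
    "pair_class A B = pair_class (graft A ts) (graft B ts)"
    "pair_class B' C = pair_class (graft B ts) (graft C us)"
    using common_middle[OF *(1,2)] by blast
  then show thesis using that * by (metis leaves_graft)
qed

lemma one_thompson_F: "\<one>\<^bsub>thompson_F\<^esub> = pair_class T T"
  using pair_class_graft[of Leaf Leaf "[T]"] by (simp add: thompson_F_def)

lemma group_thompson_F: "group thompson_F"
proof (rule groupI)
  fix x y assume x: "x \<in> carrier thompson_F" and y: "y \<in> carrier thompson_F"
  obtain A B C where "leaves A = leaves B" "leaves B = leaves C"
    "y = pair_class A B" "x = pair_class B C" using common_middle_carrier[OF y x] .
  then show "x \<otimes>\<^bsub>thompson_F\<^esub> y \<in> carrier thompson_F"
    using carrier_thompson_F mult_pair_class by metis
next
  show "\<one>\<^bsub>thompson_F\<^esub> \<in> carrier thompson_F"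
    using carrier_thompson_F one_thompson_F by blast
next
  fix x y z
  assume x: "x \<in> carrier thompson_F" and y: "y \<in> carrier thompson_F"
    and z: "z \<in> carrier thompson_F"
  obtain A B C where 1: "leaves A = leaves B" "leaves B = leaves C"
    "z = pair_class A B" "y = pair_class B C" using common_middle_carrier[OF z y] .
  obtain C' D where 2: "leaves C' = leaves D" "x = pair_class C' D"
    using x carrier_thompson_F by metis
  obtain ts us where 3: "length ts = leaves C" "length us = leaves D"
    "graft C ts = graft C' us" "x = pair_class (graft C ts) (graft D us)"
    using common_middle[of B C C' D] 1 2 by metis
  define a b c d where "a = graft A ts" and "b = graft B ts" and "c = graft C ts"
    and "d = graft D us"
  have "leaves a = leaves b" "leaves b = leaves c" "leaves c = leaves d"
    using 1 2 3 leaves_graft unfolding a_def b_def c_def d_def by metis+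
  moreover have "z = pair_class a b" "y = pair_class b c" "x = pair_class c d"
    unfolding a_def b_def c_def d_def using 1 3 pair_class_graft by metis+
  ultimately show "x \<otimes>\<^bsub>thompson_F\<^esub> y \<otimes>\<^bsub>thompson_F\<^esub> z =
      x \<otimes>\<^bsub>thompson_F\<^esub> (y \<otimes>\<^bsub>thompson_F\<^esub> z)"
    by (simp add: mult_pair_class)
next
  fix x assume "x \<in> carrier thompson_F"
  then obtain S T where *: "leaves S = leaves T" "x = pair_class S T"
    using carrier_thompson_F by metis
  show "\<one>\<^bsub>thompson_F\<^esub> \<otimes>\<^bsub>thompson_F\<^esub> x = x"
    using * mult_pair_class one_thompson_F by metis
  show "\<exists>y\<in>carrier thompson_F. y \<otimes>\<^bsub>thompson_F\<^esub> x = \<one>\<^bsub>thompson_F\<^esub>"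
    using * mult_pair_class one_thompson_F carrier_thompson_F by metis
qed

lemma inv_pair_class:
  assumes "leaves S = leaves T"
  shows "inv\<^bsub>thompson_F\<^esub> (pair_class S T) = pair_class T S"
proof (rule group.inv_equality[OF group_thompson_F])
  show "pair_class T S \<otimes>\<^bsub>thompson_F\<^esub> pair_class S T = \<one>\<^bsub>thompson_F\<^esub>"
    unfolding one_thompson_F[of S] using assms by (intro mult_pair_class) auto
qed (auto simp: carrier_thompson_F intro: assms assms[symmetric])

lemma reverse_shift_pair_class:
  assumes "leaves S = leaves T"
  shows "reverse_shift (pair_class S T) = pair_class (Caret S Leaf) (Caret T Leaf)"
proof -
  let ?f = "\<lambda>(S, T). (Caret S Leaf, Caret T Leaf)"
  have f: "(?f (A, B), ?f (A', B')) \<in> pair_equiv"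
    if eq: "((A, B), (A', B')) \<in> pair_equiv" for A B A' B'
  proof -
    have l: "leaves A = leaves B" "leaves A' = leaves B'"
      using eq by (auto simp: pair_equiv_def tree_pairs_def)
    obtain ts us where t: "length ts = leaves A" "length us = leaves A'"
      "graft A ts = graft A' us" "graft B ts = graft B' us"
      using eq l unfolding pair_equiv_iff expands_def by auto
    have "expands (?f (A, B)) (?f (graft A ts, graft B ts))"
      using t l unfolding expands_def by (intro exI[of _ "ts @ [Leaf]"]) (simp add: graft_Caret)
    moreover have "expands (?f (A', B')) (?f (graft A ts, graft B ts))"
      using t l unfolding expands_def by (intro exI[of _ "us @ [Leaf]"]) (simp add: graft_Caret)
    ultimately show ?thesis
      using l unfolding pair_equiv_iff by (auto simp: tree_pairs_def)
  qed
  show ?thesis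
  proof (intro equalityI subsetI)
    fix p assume "p \<in> reverse_shift (pair_class S T)"
    then obtain S' T' where "((S, T), (S', T')) \<in> pair_equiv" "(?f (S', T'), p) \<in> pair_equiv"
      by (auto simp: reverse_shift_def pair_class_def)
    then have "(?f (S, T), p) \<in> pair_equiv"
      using f[of S T S' T'] equiv_pair_equiv by (meson equivE transD)
    then show "p \<in> pair_class (Caret S Leaf) (Caret T Leaf)"
      by (simp add: pair_class_def)
  next
    fix p assume "p \<in> pair_class (Caret S Leaf) (Caret T Leaf)"
    moreover have "(S, T) \<in> pair_class S T"
      using assms by (auto simp: pair_class_def pair_equiv_def tree_pairs_def)
    ultimately show "p \<in> reverse_shift (pair_class S T)"
      unfolding reverse_shift_def pair_class_def by force
  qed
qed

end

(* The word length on F is comparable to the least number of leaves of a representing tree pair.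
   Multiplication by a generator enlarges a tree pair by a bounded number of leaves, because two
   trees have a common expansion with fewer leaves than both have together.  Conversely, x_0 and x_1
   rotate a tree at the root and at the right child of the root, and linearly many such rotations
   turn any tree into a left comb, so (S, T) is a product of linearly many generators.
   The reverse shift is an injective homomorphism, and it changes the least number of leaves by at
   most one. *)
theory Submission
  imports Defs
begin

section \<open>Words of bounded length\<close>

text \<open>Bounding the length instead of fixing it makes estimates additive under products;
  \<open>LEAST\<close> then enters only through the two conversions to \<open>word_length\<close>
  below.\<close>

definition has_word :: "('a, 'b) monoid_scheme \<Rightarrow> 'a set \<Rightarrow> nat \<Rightarrow> 'a \<Rightarrow> bool" where
  "has_word G S k g \<longleftrightarrow>
     (\<exists>ws. length ws \<le> k \<and> set ws \<subseteq> S \<union> m_inv G ` S \<and> foldr (mult G) ws \<one>\<^bsub>G\<^esub> = g)"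

lemma word_length_le: "has_word G S k g \<Longrightarrow> word_length G S g \<le> k"
  unfolding has_word_def word_length_def by (elim exE conjE) (rule order_trans[OF Least_le], auto)

text \<open>The premise supplies some word for \<open>g\<close>; without one, \<open>LEAST\<close>
  would range over an empty set.\<close>

lemma has_word_word_length: "has_word G S k g \<Longrightarrow> has_word G S (word_length G S g) g"
  unfolding has_word_def word_length_def by (rule LeastI2_ex) auto

lemma has_word_mono: "has_word G S k g \<Longrightarrow> k \<le> m \<Longrightarrow> has_word G S m g"
  unfolding has_word_def by (elim ex_forward conj_forward) auto

lemma (in group) foldr_mult_closed:
  "set ws \<subseteq> carrier G \<Longrightarrow> foldr (\<otimes>) ws \<one> \<in> carrier G"
  by (induction ws) auto

lemma (in group) foldr_mult_append:
  "set vs \<subseteq> carrier G \<Longrightarrow> set ws \<subseteq> carrier G \<Longrightarrow>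
     foldr (\<otimes>) (vs @ ws) \<one> = foldr (\<otimes>) vs \<one> \<otimes> foldr (\<otimes>) ws \<one>"
  by (induction vs) (auto simp: m_assoc foldr_mult_closed simp del: foldr_append)

lemma (in group) has_word_mult:
  assumes S: "S \<subseteq> carrier G" and "has_word G S k g" "has_word G S m h"
  shows "has_word G S (k + m) (g \<otimes> h)"
proof -
  obtain vs ws where *: "length vs \<le> k" "set vs \<subseteq> S \<union> m_inv G ` S" "foldr (\<otimes>) vs \<one> = g"
    "length ws \<le> m" "set ws \<subseteq> S \<union> m_inv G ` S" "foldr (\<otimes>) ws \<one> = h"
    using assms unfolding has_word_def by blast
  have "S \<union> m_inv G ` S \<subseteq> carrier G" using S by auto
  then have "foldr (\<otimes>) (vs @ ws) \<one> = g \<otimes> h" using * by (subst foldr_mult_append) auto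
  then show ?thesis using * unfolding has_word_def by (intro exI[of _ "vs @ ws"]) auto
qed

text \<open>Inverting a product reverses the word and inverts each letter, and the alphabet is
  closed under inversion.\<close>

lemma (in group) has_word_inv:
  assumes S: "S \<subseteq> carrier G" and "has_word G S k g"
  shows "has_word G S k (inv g)"
proof -
  have SI: "S \<union> m_inv G ` S \<subseteq> carrier G" using S by auto
  have "has_word G S (length ws) (inv (foldr (\<otimes>) ws \<one>))"
    if "set ws \<subseteq> S \<union> m_inv G ` S" for ws
    using that
  proof (induction ws)
    case Nil
    then show ?case by (auto simp: has_word_def)
  next
    case (Cons w ws)
    have w: "w \<in> carrier G" and ws: "foldr (\<otimes>) ws \<one> \<in> carrier G"
      using Cons.prems SI foldr_mult_closed[of ws] by auto
    have "inv w \<in> S \<union> m_inv G ` S" using Cons.prems S by auto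
    then have "has_word G S 1 (inv w)"
      using w unfolding has_word_def by (intro exI[of _ "[inv w]"]) auto
    then have "has_word G S (length ws + 1) (inv (foldr (\<otimes>) ws \<one>) \<otimes> inv w)"
      using Cons by (intro has_word_mult[OF S]) auto
    then show ?case using w ws by (simp add: inv_mult_group)
  qed
  moreover obtain ws where "length ws \<le> k" "set ws \<subseteq> S \<union> m_inv G ` S" "foldr (\<otimes>) ws \<one> = g"
    using assms(2) unfolding has_word_def by blast
  ultimately show ?thesis by (auto intro: has_word_mono)
qed

section \<open>The word length is at most linear in the number of leaves\<close>

abbreviation F_word :: "nat \<Rightarrow> (tree \<times> tree) set \<Rightarrow> bool" where
  "F_word \<equiv> has_word thompson_F {gen_x 0, gen_x 1}"

lemma leaves_neq_0 [simp]: "leaves T \<noteq> 0"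
  by (simp add: neq0_conv)

lemma leaves_ge_1 [simp]: "Suc 0 \<le> leaves T"
  by (simp add: Suc_le_eq)

lemma leaves_eq_1_iff: "leaves T = 1 \<longleftrightarrow> T = Leaf"
  by (cases T) (auto simp: add_is_1)

lemma leaves_right_comb: "leaves (right_comb n) = Suc n"
  by (induction n) auto

lemma leaves_gen_tree: "leaves (gen_tree n) = n + 3"
  by (induction n) auto

lemma gen_x_carrier: "{gen_x 0, gen_x 1} \<subseteq> carrier thompson_F"
  unfolding gen_x_def carrier_thompson_F insert_subset
  by (intro conjI exI refl empty_subsetI) (simp_all only: leaves_right_comb leaves_gen_tree)

text \<open>Grafting \<open>a\<close>, \<open>b\<close>, \<open>c\<close> at the matching leaves of
  the defining pair keeps its class, so every rotation at a root represents the same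
  element.\<close>

lemma gen_x_0_rotation:
  "pair_class (Caret a (Caret b c)) (Caret (Caret a b) c) = gen_x 0"
  unfolding gen_x_def
  using pair_class_graft[of "right_comb 2" "gen_tree 0" "[a, b, c]"]
  by (simp add: numeral_2_eq_2 graft.simps)

lemma gen_x_1_rotation:
  "pair_class (Caret a (Caret b (Caret c d))) (Caret a (Caret (Caret b c) d)) = gen_x 1"
  unfolding gen_x_def
  using pair_class_graft[of "right_comb 3" "gen_tree 1" "[a, b, c, d]"]
  by (simp add: numeral_3_eq_3 graft.simps)

text \<open>A pair is read as a move from its first tree to its second, and moves are chained. The
  later move is the left factor of the product, hence the swapped assumptions.\<close>

lemma F_word_trans:
  assumes "leaves A = leaves B" "leaves B = leaves C"
    and "F_word k (pair_class A B)" "F_word m (pair_class B C)"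
  shows "F_word (k + m) (pair_class A C)"
  using group.has_word_mult[OF group_thompson_F gen_x_carrier assms(4,3)] mult_pair_class assms
  by (simp add: add.commute)

lemma F_word_sym:
  "leaves A = leaves B \<Longrightarrow> F_word k (pair_class A B) \<Longrightarrow> F_word k (pair_class B A)"
  using group.has_word_inv[OF group_thompson_F gen_x_carrier] inv_pair_class by metis

lemma F_word_refl: "F_word 0 (pair_class T T)"
  unfolding has_word_def by (intro exI[of _ "[]"]) (simp add: one_thompson_F[of T])

lemma F_word_gen: "g \<in> {gen_x 0, gen_x 1} \<Longrightarrow> F_word 1 g"
  using gen_x_carrier group.is_monoid[OF group_thompson_F] unfolding has_word_def
  by (intro exI[of _ "[g]"]) (auto simp: monoid.r_one)

lemma F_word_rotate_0:
  "F_word 1 (pair_class (Caret a (Caret b c)) (Caret (Caret a b) c))"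
  using gen_x_0_rotation F_word_gen by auto

lemma F_word_rotate_1:
  "F_word 1 (pair_class (Caret a (Caret b (Caret c d))) (Caret a (Caret (Caret b c) d)))"
  using gen_x_1_rotation F_word_gen by auto

section \<open>Turning a tree into a left comb by rotations\<close>

fun left_comb :: "nat \<Rightarrow> tree" where
  "left_comb 0 = Leaf"
| "left_comb (Suc n) = Caret (left_comb n) Leaf"

lemma leaves_left_comb [simp]: "leaves (left_comb n) = Suc n"
  by (induction n) auto

text \<open>The number of rotations needed to turn \<open>Caret (left_comb k) R\<close> into a left comb.\<close>

fun comb_cost :: "tree \<Rightarrow> nat" where
  "comb_cost Leaf = 0"
| "comb_cost (Caret l r) = 2 * leaves l + comb_cost r - 1"

lemma comb_cost_le: "comb_cost R < 2 * leaves R"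
  by (induction R) auto

text \<open>If the left child of \<open>R\<close> is a leaf, a rotation at the root moves it onto
  the comb; otherwise an inverse rotation at the right child shrinks that left child. Either move
  lowers \<open>comb_cost\<close> by exactly one.\<close>

lemma F_word_Caret_left_comb:
  "F_word (comb_cost R) (pair_class (Caret (left_comb k) R) (left_comb (k + leaves R)))"
proof (induction "comb_cost R" arbitrary: R k rule: less_induct)
  case less
  show ?case
  proof (cases R)
    case Leaf
    then show ?thesis using F_word_refl by simp
  next
    case R: (Caret l r)
    show ?thesis
    proof (cases l)
      case Leaf
      have "F_word (comb_cost r)
          (pair_class (Caret (left_comb (Suc k)) r) (left_comb (Suc k + leaves r)))"
        using R Leaf by (intro less) auto
      then have "F_word (1 + comb_cost r)
          (pair_class (Caret (left_comb k) R) (left_comb (Suc k + leaves r)))"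
        using R Leaf F_word_rotate_0[of "left_comb k" Leaf r] by (intro F_word_trans) auto
      then show ?thesis using R Leaf by simp
    next
      case l: (Caret e f)
      let ?R = "Caret e (Caret f r)"
      \<comment> \<open>The doubled leaf counts agree on both sides; the additional caret on the
        right spine of \<open>?R\<close> accounts for the difference. The case split rules out
        truncated subtraction.\<close>
      have cost: "comb_cost R = 1 + comb_cost ?R"
        using R l by (cases "leaves f") auto
      then have "F_word (comb_cost ?R)
          (pair_class (Caret (left_comb k) ?R) (left_comb (k + leaves ?R)))"
        by (intro less) auto
      then have "F_word (1 + comb_cost ?R)
          (pair_class (Caret (left_comb k) R) (left_comb (k + leaves ?R)))"
        using R l F_word_sym[OF _ F_word_rotate_1[of "left_comb k" e f r]]
        by (intro F_word_trans) auto
      then show ?thesis using R l cost by (simp add: add.assoc)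
    qed
  qed
qed

text \<open>Inverse rotations at the root first shrink the left subtree to a leaf, which is
  \<open>left_comb 0\<close>; the preceding lemma finishes.\<close>

lemma F_word_left_comb: "F_word (3 * leaves T) (pair_class T (left_comb (leaves T - 1)))"
proof (cases T)
  case Leaf
  then show ?thesis using has_word_mono[OF F_word_refl] by simp
next
  case T: (Caret L R)
  \<comment> \<open>The summand \<open>leaves L\<close> pays for the first phase. The rest bounds
    \<open>comb_cost\<close> in the second phase through the total leaf count, which rotations
    preserve.\<close>
  have "F_word (leaves L + 2 * (leaves L + leaves R))
      (pair_class (Caret L R) (left_comb (leaves L + leaves R - 1)))"
  proof (induction L arbitrary: R)
    case Leaf
    have "F_word (comb_cost R) (pair_class (Caret Leaf R) (left_comb (leaves R)))"
      using F_word_Caret_left_comb[of R 0] by simp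
    then show ?case using comb_cost_le[of R] by (auto elim: has_word_mono)
  next
    case (Caret a b)
    have "F_word (leaves a + 2 * (leaves a + leaves (Caret b R)))
        (pair_class (Caret a (Caret b R)) (left_comb (leaves a + leaves (Caret b R) - 1)))"
      by (rule Caret)
    moreover have "leaves a > 0" "leaves b > 0" by simp_all
    ultimately have "F_word (1 + (leaves a + 2 * (leaves a + leaves (Caret b R))))
        (pair_class (Caret (Caret a b) R) (left_comb (leaves a + leaves (Caret b R) - 1)))"
      by (intro F_word_trans[OF _ _ F_word_sym[OF _ F_word_rotate_0]]) auto
    then have "F_word (leaves (Caret a b) + 2 * (leaves (Caret a b) + leaves R))
        (pair_class (Caret (Caret a b) R) (left_comb (leaves a + leaves (Caret b R) - 1)))"
      by (rule has_word_mono) simp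
    then show ?case by (simp add: add.assoc)
  qed
  then show ?thesis using T by (auto elim: has_word_mono)
qed

definition has_pair :: "nat \<Rightarrow> (tree \<times> tree) set \<Rightarrow> bool" where
  "has_pair k w \<longleftrightarrow> (\<exists>S T. leaves S = leaves T \<and> leaves S \<le> k \<and> w = pair_class S T)"

lemma has_pair_mono: "has_pair k w \<Longrightarrow> k \<le> m \<Longrightarrow> has_pair m w"
  unfolding has_pair_def by (elim ex_forward conj_forward) auto

text \<open>The path from \<open>S\<close> to \<open>T\<close> runs through their common left comb,
  at a cost of three moves per leaf each way.\<close>

lemma has_pair_F_word: "has_pair k w \<Longrightarrow> F_word (6 * k) w"
proof -
  assume "has_pair k w"
  then obtain S T where *: "leaves S = leaves T" "leaves S \<le> k" "w = pair_class S T"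
    unfolding has_pair_def by blast
  have "F_word (3 * leaves S + 3 * leaves T) (pair_class S T)"
    using F_word_left_comb[of S] F_word_sym[OF _ F_word_left_comb[of T]] *(1) leaves_pos[of T]
    by (intro F_word_trans[of S "left_comb (leaves T - 1)"]) (auto simp del: leaves_pos)
  then show ?thesis using * by (auto elim: has_word_mono)
qed

section \<open>The number of leaves is at most linear in the word length\<close>

text \<open>The common expansion is the overlay of the trees: opposite a leaf it is the other
  subtree, which gives strictness, and at two carets the bounds of the subtrees add.\<close>

lemma graft_common_bound:
  "\<exists>ts us. length ts = leaves S \<and> length us = leaves T \<and> graft S ts = graft T us \<and>
     leaves (graft S ts) < leaves S + leaves T"
proof (induction S arbitrary: T)
  case Leaf
  show ?case
    by (intro exI[of _ "[T]"] exI[of _ "replicate (leaves T) Leaf"])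
      (simp add: graft_Leafs graft.simps)
next
  case (Caret l r)
  show ?case
  proof (cases T)
    case Leaf
    then show ?thesis
      by (intro exI[of _ "replicate (leaves (Caret l r)) Leaf"] exI[of _ "[Caret l r]"])
        (simp only: graft_Leafs, simp)
  next
    case T: (Caret l' r')
    obtain ts us where 1: "length ts = leaves l" "length us = leaves l'" "graft l ts = graft l' us"
      "leaves (graft l ts) < leaves l + leaves l'"
      using Caret.IH(1) by blast
    obtain ts' us' where 2: "length ts' = leaves r" "length us' = leaves r'"
      "graft r ts' = graft r' us'" "leaves (graft r ts') < leaves r + leaves r'"
      using Caret.IH(2) by blast
    show ?thesis using 1 2 T
      by (intro exI[of _ "ts @ ts'"] exI[of _ "us @ us'"]) (simp add: graft_Caret)
  qed
qed

lemma has_pair_mult: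
  assumes "has_pair k w" "has_pair m x"
  shows "has_pair (k + m) (x \<otimes>\<^bsub>thompson_F\<^esub> w)"
proof -
  obtain A B where w: "leaves A = leaves B" "leaves A \<le> k" "w = pair_class A B"
    using assms unfolding has_pair_def by blast
  obtain C D where x: "leaves C = leaves D" "leaves C \<le> m" "x = pair_class C D"
    using assms unfolding has_pair_def by blast
  obtain ts us where *: "length ts = leaves B" "length us = leaves C" "graft B ts = graft C us"
     "leaves (graft B ts) < leaves B + leaves C"
    using graft_common_bound by blast
  have l: "leaves (graft A ts) = leaves (graft B ts)" "leaves (graft C us) = leaves (graft D us)"
    using leaves_graft[of ts A] leaves_graft[of ts B] leaves_graft[of us C] leaves_graft[of us D]
      w(1) x(1) *(1,2) by simp_all
  have "w = pair_class (graft A ts) (graft B ts)"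
    using pair_class_graft[of A B ts] w(1,3) *(1) by simp
  moreover have "x = pair_class (graft B ts) (graft D us)"
    using pair_class_graft[of C D us] x(1,3) *(2,3) by simp
  ultimately have "x \<otimes>\<^bsub>thompson_F\<^esub> w = pair_class (graft A ts) (graft D us)"
    using l *(3) by (simp add: mult_pair_class)
  moreover have "leaves (graft A ts) = leaves (graft D us)" "leaves (graft A ts) \<le> k + m"
    using l *(3,4) w(1,2) x(2) by simp_all
  ultimately show ?thesis unfolding has_pair_def by blast
qed

lemma has_pair_inv:
  "has_pair k w \<Longrightarrow> has_pair k (inv\<^bsub>thompson_F\<^esub> w)"
  unfolding has_pair_def using inv_pair_class by metis

lemma has_pair_gen: "g \<in> {gen_x 0, gen_x 1} \<Longrightarrow> has_pair 4 g"
proof -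
  have "has_pair 4 (gen_x n)" if "n \<le> 1" for n
    using that unfolding has_pair_def gen_x_def
    \<comment> \<open>The bound 4 is attained by the trees of \<open>gen_x 1\<close>; those of
      \<open>gen_x 0\<close> have three leaves.\<close>
    by (intro exI[of _ "right_comb (n + 2)"] exI[of _ "gen_tree n"])
      (simp add: leaves_right_comb leaves_gen_tree)
  then show "g \<in> {gen_x 0, gen_x 1} \<Longrightarrow> has_pair 4 g" by auto
qed

text \<open>Each letter adds at most four leaves; the summand 1 is the single leaf representing the
  identity.\<close>

lemma F_word_has_pair:
  assumes "F_word k w"
  shows "has_pair (4 * k + 1) w"
proof -
  let ?X = "{gen_x 0, gen_x 1} \<union> m_inv thompson_F ` {gen_x 0, gen_x 1}"
  obtain ws where ws: "length ws \<le> k" "set ws \<subseteq> ?X" "foldr (mult thompson_F) ws \<one>\<^bsub>thompson_F\<^esub> = w"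
    using assms unfolding has_word_def by blast
  have "has_pair (4 * length ws + 1) (foldr (mult thompson_F) ws \<one>\<^bsub>thompson_F\<^esub>)"
    using ws(2)
  proof (induction ws)
    case Nil
    show ?case unfolding has_pair_def
      by (auto intro!: exI[of _ Leaf] simp: one_thompson_F[of Leaf])
  next
    case (Cons x ws)
    have "x \<in> ?X" using Cons.prems by auto
    then have "has_pair 4 x" using has_pair_gen has_pair_inv by blast
    then show ?case using has_pair_mult[of "4 * length ws + 1" _ 4 x] Cons by (simp add: algebra_simps)
  qed
  then have "has_pair (4 * length ws + 1) w" using ws(3) by simp
  then show ?thesis by (rule has_pair_mono) (use ws(1) in simp)
qed

section \<open>The reverse shift\<close>

lemma has_pair_carrier: "has_pair k w \<Longrightarrow> w \<in> carrier thompson_F"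
  unfolding has_pair_def carrier_thompson_F by blast

lemma carrier_has_pair: "w \<in> carrier thompson_F \<Longrightarrow> \<exists>k. has_pair k w"
  unfolding has_pair_def carrier_thompson_F by blast

lemma has_pair_reverse_shift: "has_pair k w \<Longrightarrow> has_pair (Suc k) (reverse_shift w)"
proof -
  assume "has_pair k w"
  then obtain S T where *: "leaves S = leaves T" "leaves S \<le> k" "w = pair_class S T"
    unfolding has_pair_def by blast
  then show ?thesis unfolding has_pair_def
    by (intro exI[of _ "Caret S Leaf"] exI[of _ "Caret T Leaf"]) (simp add: reverse_shift_pair_class)
qed

text \<open>Every tree has a leaf, so leaf counts of prefixes increase strictly and determine where
  the list is cut.\<close>

lemma append_eq_same_leaves:
  assumes "xs @ ys = us @ vs" "sum_list (map leaves xs) = sum_list (map leaves us)"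
  shows "xs = us"
  using assms
proof (induction xs arbitrary: us)
  case Nil
  then show ?case by (cases us) auto
next
  case (Cons x xs)
  then show ?case by (cases us) auto
qed

text \<open>The root carets of a pair representing \<open>reverse_shift w\<close> correspond to each other, so its left
  subtrees represent \<open>w\<close>.\<close>

lemma reverse_shift_has_pair:
  assumes "w \<in> carrier thompson_F" "has_pair k (reverse_shift w)"
  shows "has_pair k w"
proof -
  obtain S T where w: "leaves S = leaves T" "w = pair_class S T"
    using assms carrier_thompson_F by metis
  obtain A B where AB: "leaves A = leaves B" "leaves A \<le> k" "reverse_shift w = pair_class A B"
    using assms unfolding has_pair_def by blast
  have "((A, B), (Caret S Leaf, Caret T Leaf)) \<in> pair_equiv"
    using w AB by (subst pair_class_eq_iff[symmetric]) (auto simp: reverse_shift_pair_class)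
  then obtain ts us' where t: "length ts = leaves A" "length us' = leaves (Caret S Leaf)"
    "graft A ts = graft (Caret S Leaf) us'" "graft B ts = graft (Caret T Leaf) us'"
    unfolding pair_equiv_iff expands_def by auto
  from t(2) obtain us u where us': "us' = us @ u" "length us = leaves S" "length u = leaves Leaf"
    by (rule split_Caret)
  have A: "graft A ts = Caret (graft S us) (graft Leaf u)"
    using t us' by (simp add: graft_Caret)
  have B: "graft B ts = Caret (graft T us) (graft Leaf u)"
    using t us' w by (simp add: graft_Caret)
  show ?thesis
  proof (cases A)
    case Leaf
    then have "B = Leaf" using AB leaves_eq_1_iff[of B] by simp
    \<comment> \<open>Both expansions are then the one tree in \<open>ts\<close>, so
      \<open>w\<close> is the identity.\<close>
    then have "graft S us = graft T us" using A B Leaf by simp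
    then have "w = pair_class (graft S us) (graft S us)"
      using w us' pair_class_graft[of S T us] by simp
    then have "w = pair_class Leaf Leaf" using one_thompson_F by metis
    then show ?thesis using AB(2) Leaf unfolding has_pair_def by (intro exI[of _ Leaf]) simp
  next
    case Ac: (Caret A1 A2)
    then have "B \<noteq> Leaf" using AB leaves_eq_1_iff[of A] by auto
    then obtain B1 B2 where Bc: "B = Caret B1 B2" by (cases B) auto
    obtain xs ys where xs: "ts = xs @ ys" "length xs = leaves A1" "length ys = leaves A2"
      using t(1) Ac split_Caret by metis
    obtain vs zs where vs: "ts = vs @ zs" "length vs = leaves B1" "length zs = leaves B2"
      using t(1) AB Bc split_Caret by metis
    have gA: "graft A1 xs = graft S us" using A Ac xs by (simp add: graft_Caret)
    have gB: "graft B1 vs = graft T us" using B Bc vs by (simp add: graft_Caret)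
    \<comment> \<open>The root carets of \<open>A\<close> and \<open>B\<close> might cut
      \<open>ts\<close> at different places. Both left parts expand to trees with equally many
      leaves, so the cuts coincide.\<close>
    have "leaves (graft S us) = leaves (graft T us)" using us' w by (simp add: leaves_graft)
    then have "sum_list (map leaves xs) = sum_list (map leaves vs)"
      using gA gB xs vs leaves_graft by metis
    then have "xs = vs" using append_eq_same_leaves xs vs by metis
    then have "leaves A1 = leaves B1" using xs vs by simp
    then have "pair_class A1 B1 = pair_class (graft S us) (graft T us)"
      using pair_class_graft[of A1 B1 xs] gA gB xs \<open>xs = vs\<close> by simp
    also have "\<dots> = w" using w us' pair_class_graft by metis
    finally show ?thesis using AB(2) Ac \<open>leaves A1 = leaves B1\<close> unfolding has_pair_def
      by (intro exI[of _ A1] exI[of _ B1]) simp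
  qed
qed

lemma reverse_shift_carrier: "w \<in> carrier thompson_F \<Longrightarrow> reverse_shift w \<in> carrier thompson_F"
  using carrier_has_pair has_pair_carrier has_pair_reverse_shift by blast

text \<open>Representatives with a common middle tree keep one after the shift. Distances between
  images thus become lengths of shifted elements.\<close>

lemma reverse_shift_inv_mult:
  assumes "u \<in> carrier thompson_F" "v \<in> carrier thompson_F"
  shows "reverse_shift (inv\<^bsub>thompson_F\<^esub> u \<otimes>\<^bsub>thompson_F\<^esub> v) =
    inv\<^bsub>thompson_F\<^esub> (reverse_shift u) \<otimes>\<^bsub>thompson_F\<^esub> reverse_shift v"
proof -
  have "inv\<^bsub>thompson_F\<^esub> u \<in> carrier thompson_F"
    using assms group.inv_closed[OF group_thompson_F] by blast
  from common_middle_carrier[OF assms(2) this] obtain A B C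
    where *: "leaves A = leaves B" "leaves B = leaves C" "v = pair_class A B"
      "inv\<^bsub>thompson_F\<^esub> u = pair_class B C" .
  then have "u = pair_class C B"
    using group.inv_inv[OF group_thompson_F assms(1)] inv_pair_class by metis
  then show ?thesis using * by (simp add: mult_pair_class reverse_shift_pair_class inv_pair_class)
qed

section \<open>Iterates of the shift and the distance estimates\<close>

lemma funpow_reverse_shift_carrier:
  "w \<in> carrier thompson_F \<Longrightarrow> (reverse_shift ^^ n) w \<in> carrier thompson_F"
  by (induction n) (auto simp: reverse_shift_carrier)

lemma funpow_reverse_shift_inv_mult:
  assumes "u \<in> carrier thompson_F" "v \<in> carrier thompson_F"
  shows "(reverse_shift ^^ n) (inv\<^bsub>thompson_F\<^esub> u \<otimes>\<^bsub>thompson_F\<^esub> v) =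
    inv\<^bsub>thompson_F\<^esub> ((reverse_shift ^^ n) u) \<otimes>\<^bsub>thompson_F\<^esub> (reverse_shift ^^ n) v"
  by (induction n) (simp_all add: assms reverse_shift_inv_mult funpow_reverse_shift_carrier)

lemma has_pair_funpow_reverse_shift:
  "has_pair k w \<Longrightarrow> has_pair (k + n) ((reverse_shift ^^ n) w)"
  by (induction n) (auto simp: has_pair_reverse_shift)

lemma funpow_reverse_shift_has_pair:
  "w \<in> carrier thompson_F \<Longrightarrow> has_pair k ((reverse_shift ^^ n) w) \<Longrightarrow> has_pair k w"
  by (induction n) (auto simp: reverse_shift_has_pair funpow_reverse_shift_carrier)

abbreviation F_length :: "(tree \<times> tree) set \<Rightarrow> nat" where
  "F_length \<equiv> word_length thompson_F {gen_x 0, gen_x 1}"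

text \<open>Any representing pair yields a word, so a shortest word exists and bounds the leaf count
  in turn.\<close>

lemma has_pair_F_length:
  assumes "w \<in> carrier thompson_F"
  shows "has_pair (4 * F_length w + 1) w"
proof -
  obtain k where "has_pair k w" using carrier_has_pair[OF assms] ..
  then show ?thesis by (intro F_word_has_pair has_word_word_length[OF has_pair_F_word])
qed

lemma F_length_le: "has_pair k w \<Longrightarrow> F_length w \<le> 6 * k"
  by (intro word_length_le has_pair_F_word)

theorem theorem3p2:
  fixes n :: nat
  shows "quasi_isometric_embedding (carrier thompson_F) dist_F (carrier thompson_F) dist_F
           (reverse_shift ^^ n)"
proof -
  \<comment> \<open>24 is six letters per leaf times four leaves per letter. In \<open>?C\<close>,
    the \<open>n\<close> counts the leaves added by the shifts and the 1 is the leaf of the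
    identity.\<close>
  let ?K = "24 :: real" and ?C = "6 * (real n + 1)"
  have "1 / ?K * dist_F u v - ?C \<le> dist_F ((reverse_shift ^^ n) u) ((reverse_shift ^^ n) v) \<and>
      dist_F ((reverse_shift ^^ n) u) ((reverse_shift ^^ n) v) \<le> ?K * dist_F u v + ?C"
    if uv: "u \<in> carrier thompson_F" "v \<in> carrier thompson_F" for u v
  proof -
    let ?w = "inv\<^bsub>thompson_F\<^esub> u \<otimes>\<^bsub>thompson_F\<^esub> v"
    let ?w' = "(reverse_shift ^^ n) ?w"
    have w: "?w \<in> carrier thompson_F"
      using uv group_thompson_F by (simp add: group.is_monoid monoid.m_closed)
    have "F_length ?w' \<le> 6 * (4 * F_length ?w + 1 + n)"
      by (intro F_length_le has_pair_funpow_reverse_shift has_pair_F_length w)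
    \<comment> \<open>Undoing the shifts costs no leaves, so \<open>n\<close> is absent from this
      bound.\<close>
    moreover have "F_length ?w \<le> 6 * (4 * F_length ?w' + 1)"
      by (intro F_length_le funpow_reverse_shift_has_pair[OF w, of _ n] has_pair_F_length
          funpow_reverse_shift_carrier w)
    ultimately have "real (F_length ?w') \<le> 24 * real (F_length ?w) + 6 * (real n + 1)"
      "real (F_length ?w) \<le> 24 * real (F_length ?w') + 6"
      by simp_all
    then show ?thesis
      unfolding word_metric_def using funpow_reverse_shift_inv_mult[OF uv, of n] by simp
  qed
  then show ?thesis
    unfolding quasi_isometric_embedding_def
    by (intro conjI exI[of _ ?K] exI[of _ ?C]) (auto intro: funpow_reverse_shift_carrier)
qed

end
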